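(* Let $1\le p<\infty$, $\delta\in(0,1]$, and $I=(0,T)$ with $0<T\le\infty$. Define the increasing map $\Psi(t):=t^\delta/\delta$ for $t\in(0,T)$. Then $$U:L^{p,\delta}(0,T)\longrightarrow L^p\bigl(0,\Psi(T)\bigr),\qquad (Uf)(s)=f\bigl((\delta s)^{1/\delta}\bigr),$$ is a linear isometric isomorphism.
   Context: $L^{p,\delta}(0,T)$ is the space of (classes of) measurable functions $f:(0,T)\to\mathbb C$ with $\int_0^T|f(t)|^p\,t^{\delta-1}\,dt<\infty$, with norm $\|f\|_{p,\delta}=\bigl(\int_0^T|f(t)|^p\,t^{\delta-1}\,dt\bigr)^{1/p}$. When $T=\infty$, $\Psi(T)=\infty$. $L^p(0,\Psi(T))$ is the usual complex Lebesgue space with Lebesgue measure. *)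

theory Defs
  imports "HOL-Analysis.Analysis"
begin

definition Lp_fun :: "'a measure \<Rightarrow> real \<Rightarrow> ('a \<Rightarrow> complex) set" where
  "Lp_fun M p = {f \<in> borel_measurable M. (\<integral>\<^sup>+x. ennreal (norm (f x) powr p) \<partial>M) < \<infinity>}"

definition Lp_rel :: "'a measure \<Rightarrow> real \<Rightarrow> (('a \<Rightarrow> complex) \<times> ('a \<Rightarrow> complex)) set" where
  "Lp_rel M p = {(f, g). f \<in> Lp_fun M p \<and> g \<in> Lp_fun M p \<and> (AE x in M. f x = g x)}"

definition Lp :: "'a measure \<Rightarrow> real \<Rightarrow> ('a \<Rightarrow> complex) set set" where
  "Lp M p = Lp_fun M p // Lp_rel M p"

definition Lp_class :: "'a measure \<Rightarrow> real \<Rightarrow> ('a \<Rightarrow> complex) \<Rightarrow> ('a \<Rightarrow> complex) set" where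
  "Lp_class M p f = Lp_rel M p `` {f}"

text \<open>
  The operations and the norm are lifted from representatives. A union of classes is
  again a class only if all the classes in it agree, so the lifting is the usual one;
  see the lemmas \<open>Lp_add_class\<close>, \<open>Lp_scale_class\<close> and \<open>Lp_norm_class\<close> below.
\<close>

definition Lp_add ::
    "'a measure \<Rightarrow> real \<Rightarrow> ('a \<Rightarrow> complex) set \<Rightarrow> ('a \<Rightarrow> complex) set \<Rightarrow> ('a \<Rightarrow> complex) set" where
  "Lp_add M p F G = (\<Union>f\<in>F. \<Union>g\<in>G. Lp_class M p (\<lambda>x. f x + g x))"

definition Lp_scale ::
    "'a measure \<Rightarrow> real \<Rightarrow> complex \<Rightarrow> ('a \<Rightarrow> complex) set \<Rightarrow> ('a \<Rightarrow> complex) set" where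
  "Lp_scale M p c F = (\<Union>f\<in>F. Lp_class M p (\<lambda>x. c * f x))"

definition Lp_norm :: "'a measure \<Rightarrow> real \<Rightarrow> ('a \<Rightarrow> complex) set \<Rightarrow> real" where
  "Lp_norm M p F = the_elem ((\<lambda>f. (\<integral>x. norm (f x) powr p \<partial>M) powr (1 / p)) ` F)"

definition Lp_linear_isometric_iso ::
    "'a measure \<Rightarrow> 'b measure \<Rightarrow> real \<Rightarrow> (('a \<Rightarrow> complex) set \<Rightarrow> ('b \<Rightarrow> complex) set) \<Rightarrow> bool" where
  "Lp_linear_isometric_iso M N p U \<longleftrightarrow>
     bij_betw U (Lp M p) (Lp N p) \<and>
     (\<forall>F\<in>Lp M p. \<forall>G\<in>Lp M p. U (Lp_add M p F G) = Lp_add N p (U F) (U G)) \<and>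
     (\<forall>c. \<forall>F\<in>Lp M p. U (Lp_scale M p c F) = Lp_scale N p c (U F)) \<and>
     (\<forall>F\<in>Lp M p. Lp_norm N p (U F) = Lp_norm M p F)"

lemma equiv_Lp_rel: "equiv (Lp_fun M p) (Lp_rel M p)"
proof (rule equivI)
  show "Lp_rel M p \<subseteq> Lp_fun M p \<times> Lp_fun M p" by (auto simp: Lp_rel_def)
  show "refl_on (Lp_fun M p) (Lp_rel M p)" by (auto simp: Lp_rel_def refl_on_def)
  show "sym (Lp_rel M p)"
    unfolding Lp_rel_def sym_def by (simp add: eq_commute)
  show "trans (Lp_rel M p)"
  proof (rule transI)
    fix f g h assume a: "(f, g) \<in> Lp_rel M p" "(g, h) \<in> Lp_rel M p"
    then have "AE x in M. f x = g x" "AE x in M. g x = h x" by (auto simp: Lp_rel_def)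
    then have "AE x in M. f x = h x" by eventually_elim simp
    with a show "(f, h) \<in> Lp_rel M p" by (auto simp: Lp_rel_def)
  qed
qed

lemma mem_Lp_class:
  "g \<in> Lp_class M p f \<longleftrightarrow> f \<in> Lp_fun M p \<and> g \<in> Lp_fun M p \<and> (AE x in M. f x = g x)"
  by (auto simp: Lp_class_def Lp_rel_def)

lemma Lp_class_in_Lp: "f \<in> Lp_fun M p \<Longrightarrow> Lp_class M p f \<in> Lp M p"
  unfolding Lp_class_def Lp_def by (rule quotientI)

lemma Lp_cases:
  assumes "F \<in> Lp M p"
  obtains f where "f \<in> Lp_fun M p" "F = Lp_class M p f"
  using assms unfolding Lp_def Lp_class_def by (metis quotientE)

lemma Lp_class_eqI:
  assumes "f \<in> Lp_fun M p" "g \<in> Lp_fun M p" "AE x in M. f x = g x"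
  shows "Lp_class M p f = Lp_class M p g"
  unfolding Lp_class_def
  by (rule equiv_class_eq[OF equiv_Lp_rel]) (use assms in \<open>auto simp: Lp_rel_def\<close>)

lemma Lp_fun_add:
  assumes p: "0 \<le> p" and f: "f \<in> Lp_fun M p" and g: "g \<in> Lp_fun M p"
  shows "(\<lambda>x. f x + g x) \<in> Lp_fun M p"
proof -
  have [measurable]: "f \<in> borel_measurable M" "g \<in> borel_measurable M"
    using f g by (auto simp: Lp_fun_def)
  have bound: "norm (a + b) powr p \<le> 2 powr p * norm a powr p + 2 powr p * norm b powr p"
    for a b :: complex
  proof -
    have "norm (a + b) \<le> 2 * max (norm a) (norm b)"
      using norm_triangle_ineq[of a b] by linarith
    then have "norm (a + b) powr p \<le> (2 * max (norm a) (norm b)) powr p"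
      using p by (intro powr_mono2) auto
    also have "\<dots> = 2 powr p * max (norm a) (norm b) powr p"
      by (simp add: powr_mult)
    also have "\<dots> \<le> 2 powr p * (norm a powr p + norm b powr p)"
      by (intro mult_left_mono) (auto simp: max_def)
    finally show ?thesis by (simp add: algebra_simps)
  qed
  have "(\<integral>\<^sup>+x. ennreal (norm (f x + g x) powr p) \<partial>M)
      \<le> (\<integral>\<^sup>+x. ennreal (2 powr p) * ennreal (norm (f x) powr p)
              + ennreal (2 powr p) * ennreal (norm (g x) powr p) \<partial>M)"
  proof (rule nn_integral_mono)
    fix x
    have "ennreal (norm (f x + g x) powr p)
        \<le> ennreal (2 powr p * norm (f x) powr p + 2 powr p * norm (g x) powr p)"
      using bound by (rule ennreal_leI)
    also have "\<dots> = ennreal (2 powr p) * ennreal (norm (f x) powr p)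
        + ennreal (2 powr p) * ennreal (norm (g x) powr p)"
      by (simp add: ennreal_plus ennreal_mult)
    finally show "ennreal (norm (f x + g x) powr p)
        \<le> ennreal (2 powr p) * ennreal (norm (f x) powr p)
          + ennreal (2 powr p) * ennreal (norm (g x) powr p)" .
  qed
  also have "\<dots> = ennreal (2 powr p) * (\<integral>\<^sup>+x. ennreal (norm (f x) powr p) \<partial>M)
      + ennreal (2 powr p) * (\<integral>\<^sup>+x. ennreal (norm (g x) powr p) \<partial>M)"
    by (simp add: nn_integral_add nn_integral_cmult)
  also have "\<dots> < \<infinity>"
    using f g by (auto simp: Lp_fun_def ennreal_mult_less_top)
  finally show ?thesis by (simp add: Lp_fun_def)
qed

lemma Lp_fun_scale:
  assumes f: "f \<in> Lp_fun M p"
  shows "(\<lambda>x. c * f x) \<in> Lp_fun M p"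
proof -
  have [measurable]: "f \<in> borel_measurable M" using f by (auto simp: Lp_fun_def)
  have "(\<integral>\<^sup>+x. ennreal (norm (c * f x) powr p) \<partial>M)
      = (\<integral>\<^sup>+x. ennreal (norm c powr p) * ennreal (norm (f x) powr p) \<partial>M)"
    by (simp add: norm_mult powr_mult ennreal_mult)
  also have "\<dots> = ennreal (norm c powr p) * (\<integral>\<^sup>+x. ennreal (norm (f x) powr p) \<partial>M)"
    by (simp add: nn_integral_cmult)
  also have "\<dots> < \<infinity>" using f by (auto simp: Lp_fun_def ennreal_mult_less_top)
  finally show ?thesis by (simp add: Lp_fun_def)
qed

lemma Lp_add_class:
  assumes p: "0 \<le> p" and f: "f \<in> Lp_fun M p" and g: "g \<in> Lp_fun M p"
  shows "Lp_add M p (Lp_class M p f) (Lp_class M p g) = Lp_class M p (\<lambda>x. f x + g x)"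
proof -
  have indep: "Lp_class M p (\<lambda>x. f' x + g' x) = Lp_class M p (\<lambda>x. f x + g x)"
    if "f' \<in> Lp_class M p f" "g' \<in> Lp_class M p g" for f' g'
  proof (rule Lp_class_eqI)
    have *: "f' \<in> Lp_fun M p" "g' \<in> Lp_fun M p" "AE x in M. f x = f' x" "AE x in M. g x = g' x"
      using that by (auto simp: mem_Lp_class)
    show "(\<lambda>x. f' x + g' x) \<in> Lp_fun M p" "(\<lambda>x. f x + g x) \<in> Lp_fun M p"
      using p f g * by (auto intro: Lp_fun_add)
    from *(3,4) show "AE x in M. f' x + g' x = f x + g x" by eventually_elim simp
  qed
  have nonempty: "f \<in> Lp_class M p f" "g \<in> Lp_class M p g"
    using f g by (simp_all add: mem_Lp_class)
  have "(\<Union>f'\<in>Lp_class M p f. \<Union>g'\<in>Lp_class M p g. Lp_class M p (\<lambda>x. f' x + g' x))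
      = (\<Union>f'\<in>Lp_class M p f. \<Union>g'\<in>Lp_class M p g. Lp_class M p (\<lambda>x. f x + g x))"
    by (intro SUP_cong refl indep)
  with nonempty show ?thesis unfolding Lp_add_def by (auto simp: UN_constant_eq)
qed

lemma Lp_scale_class:
  assumes f: "f \<in> Lp_fun M p"
  shows "Lp_scale M p c (Lp_class M p f) = Lp_class M p (\<lambda>x. c * f x)"
proof -
  have indep: "Lp_class M p (\<lambda>x. c * f' x) = Lp_class M p (\<lambda>x. c * f x)"
    if "f' \<in> Lp_class M p f" for f'
  proof (rule Lp_class_eqI)
    have *: "f' \<in> Lp_fun M p" "AE x in M. f x = f' x"
      using that by (auto simp: mem_Lp_class)
    show "(\<lambda>x. c * f' x) \<in> Lp_fun M p" "(\<lambda>x. c * f x) \<in> Lp_fun M p"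
      using f * by (auto intro: Lp_fun_scale)
    from *(2) show "AE x in M. c * f' x = c * f x" by eventually_elim simp
  qed
  have "(\<Union>f'\<in>Lp_class M p f. Lp_class M p (\<lambda>x. c * f' x))
      = (\<Union>f'\<in>Lp_class M p f. Lp_class M p (\<lambda>x. c * f x))"
    by (intro SUP_cong refl indep)
  moreover have "f \<in> Lp_class M p f" using f by (simp add: mem_Lp_class)
  ultimately show ?thesis unfolding Lp_scale_def by (auto simp: UN_constant_eq)
qed

lemma Lp_norm_class:
  assumes f: "f \<in> Lp_fun M p"
  shows "Lp_norm M p (Lp_class M p f) = (\<integral>x. norm (f x) powr p \<partial>M) powr (1 / p)"
proof -
  have *: "(\<integral>x. norm (g x) powr p \<partial>M) = (\<integral>x. norm (f x) powr p \<partial>M)"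
    if "g \<in> Lp_class M p f" for g
  proof (rule integral_cong_AE)
    have [measurable]: "f \<in> borel_measurable M" "g \<in> borel_measurable M"
      using that f by (auto simp: mem_Lp_class Lp_fun_def)
    show "(\<lambda>x. norm (g x) powr p) \<in> borel_measurable M"
      "(\<lambda>x. norm (f x) powr p) \<in> borel_measurable M" by measurable
    have "AE x in M. f x = g x" using that by (simp add: mem_Lp_class)
    then show "AE x in M. norm (g x) powr p = norm (f x) powr p" by eventually_elim simp
  qed
  have "f \<in> Lp_class M p f" using f by (simp add: mem_Lp_class)
  then have "(\<lambda>g. (\<integral>x. norm (g x) powr p \<partial>M) powr (1 / p)) ` Lp_class M p f
      = (\<lambda>g. (\<integral>x. norm (f x) powr p \<partial>M) powr (1 / p)) ` Lp_class M p f"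
    by (intro image_cong refl arg_cong[where f = "\<lambda>r. r powr (1 / p)"] *)
  also have "\<dots> = {(\<integral>x. norm (f x) powr p \<partial>M) powr (1 / p)}"
    using \<open>f \<in> Lp_class M p f\<close> by (rule image_constant)
  finally show ?thesis by (simp add: Lp_norm_def)
qed

text \<open>
  \<open>Lp (weighted_measure \<delta> T) p\<close> is the space of classes with finite integral of
  \<open>|f(t)|^p t^(\<delta> - 1)\<close> over \<open>(0, T)\<close>; the next three lemmas spell this out.
  Functions are total on \<^typ>\<open>real\<close>, but measurability, integrals and almost everywhere
  equality only see their values on the interval, so a class is determined by the
  restriction of any of its members.
\<close>

definition weighted_measure :: "real \<Rightarrow> ereal \<Rightarrow> real measure" where
  "weighted_measure \<delta> T =
     density (lebesgue_on (einterval 0 T)) (\<lambda>t. ennreal (t powr (\<delta> - 1)))"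

lemma Lp_fun_weighted_measure:
  "f \<in> Lp_fun (weighted_measure \<delta> T) p \<longleftrightarrow>
     f \<in> borel_measurable (lebesgue_on (einterval 0 T)) \<and>
     (\<integral>\<^sup>+t. ennreal (norm (f t) powr p * t powr (\<delta> - 1)) \<partial>lebesgue_on (einterval 0 T)) < \<infinity>"
proof -
  have w: "(\<lambda>t. ennreal (t powr (\<delta> - 1))) \<in> borel_measurable (lebesgue_on (einterval 0 T))"
    by (intro measurable_restrict_space1 measurable_completion) simp
  show ?thesis
  proof (cases "f \<in> borel_measurable (lebesgue_on (einterval 0 T))")
    case True
    then have "(\<lambda>t. ennreal (norm (f t) powr p)) \<in> borel_measurable (lebesgue_on (einterval 0 T))"
      by measurable
    then show ?thesis using True w
      by (simp add: Lp_fun_def weighted_measure_def nn_integral_density ennreal_mult mult.commute)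
  qed (simp add: Lp_fun_def weighted_measure_def)
qed

lemma AE_weighted_measure:
  "(AE t in weighted_measure \<delta> T. P t) \<longleftrightarrow> (AE t in lebesgue_on (einterval 0 T). P t)"
proof -
  have w: "(\<lambda>t. ennreal (t powr (\<delta> - 1))) \<in> borel_measurable (lebesgue_on (einterval 0 T))"
    by (intro measurable_restrict_space1 measurable_completion) simp
  show ?thesis unfolding weighted_measure_def AE_density[OF w]
    by (rule AE_cong) (auto simp: einterval_def)
qed

lemma Lp_norm_weighted_measure:
  assumes f: "f \<in> Lp_fun (weighted_measure \<delta> T) p"
  shows "Lp_norm (weighted_measure \<delta> T) p (Lp_class (weighted_measure \<delta> T) p f) =
    (\<integral>t. norm (f t) powr p * t powr (\<delta> - 1) \<partial>lebesgue_on (einterval 0 T)) powr (1 / p)"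
proof -
  have w: "(\<lambda>t. t powr (\<delta> - 1)) \<in> borel_measurable (lebesgue_on (einterval 0 T))"
    by (intro measurable_restrict_space1 measurable_completion) simp
  have "f \<in> borel_measurable (lebesgue_on (einterval 0 T))"
    using f by (simp add: Lp_fun_weighted_measure)
  then have "(\<lambda>t. norm (f t) powr p) \<in> borel_measurable (lebesgue_on (einterval 0 T))"
    by measurable
  then show ?thesis unfolding Lp_norm_class[OF f] using w
    by (simp add: weighted_measure_def integral_density mult.commute)
qed

definition Psi :: "real \<Rightarrow> real \<Rightarrow> real" where
  "Psi \<delta> t = t powr \<delta> / \<delta>"

definition Psi_end :: "real \<Rightarrow> ereal \<Rightarrow> ereal" where
  "Psi_end \<delta> T = (if T = \<infinity> then \<infinity> else ereal (Psi \<delta> (real_of_ereal T)))"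

definition U_fun :: "real \<Rightarrow> (real \<Rightarrow> complex) \<Rightarrow> real \<Rightarrow> complex" where
  "U_fun \<delta> f s = f ((\<delta> * s) powr (1 / \<delta>))"

definition U_op :: "real \<Rightarrow> real \<Rightarrow> ereal \<Rightarrow> (real \<Rightarrow> complex) set \<Rightarrow> (real \<Rightarrow> complex) set" where
  "U_op p \<delta> T F =
     (\<Union>f\<in>F. Lp_class (lebesgue_on (einterval 0 (Psi_end \<delta> T))) p (U_fun \<delta> f))"

end

theory Submission
  imports Defs
begin

text \<open>
  \<open>\<Psi>\<close> is a bijection of \<open>(0, T)\<close> onto \<open>(0, \<Psi>(T))\<close> with derivative \<open>t^(\<delta> - 1)\<close>, so by change of
  variables it carries the weighted measure to Lebesgue measure. Its inverse is
  \<open>s \<mapsto> (\<delta> s)^(1/\<delta>)\<close>, and composition with an invertible measure preserving map is an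
  isometric isomorphism of \<open>L\<^sup>p\<close> spaces.
\<close>

locale measure_preserving_iso =
  fixes M :: "'a measure" and N :: "'b measure" and \<phi> :: "'b \<Rightarrow> 'a" and \<psi> :: "'a \<Rightarrow> 'b"
  assumes measurable_\<phi>: "\<phi> \<in> measurable N M" and measurable_\<psi>: "\<psi> \<in> measurable M N"
    and distr_\<phi>: "distr N M \<phi> = M"
    and \<phi>_\<psi>: "\<And>x. x \<in> space M \<Longrightarrow> \<phi> (\<psi> x) = x"
    and \<psi>_\<phi>: "\<And>y. y \<in> space N \<Longrightarrow> \<psi> (\<phi> y) = y"
begin

text \<open>The push-forward of \<open>M\<close> along \<psi> is that of \<open>N\<close> along
  \<open>\<psi> \<circ> \<phi>\<close>, which is the identity on \<open>space N\<close>. So every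
  fact of the locale also holds with the two sides exchanged.\<close>

lemma inverse: "measure_preserving_iso N M \<psi> \<phi>"
proof
  have "distr M N \<psi> = distr (distr N M \<phi>) N \<psi>" by (simp add: distr_\<phi>)
  also have "\<dots> = distr N N (\<psi> \<circ> \<phi>)"
    by (rule distr_distr[OF measurable_\<psi> measurable_\<phi>])
  also have "\<dots> = distr N N (\<lambda>y. y)" by (rule distr_cong) (simp_all add: \<psi>_\<phi>)
  finally show "distr M N \<psi> = N" by simp
qed (fact measurable_\<phi> measurable_\<psi> \<phi>_\<psi> \<psi>_\<phi>)+

lemma Lp_fun_comp:
  assumes "f \<in> Lp_fun M p"
  shows "(\<lambda>y. f (\<phi> y)) \<in> Lp_fun N p"
proof -
  have f[measurable]: "f \<in> borel_measurable M"
    and fin: "(\<integral>\<^sup>+x. ennreal (norm (f x) powr p) \<partial>M) < \<infinity>"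
    using assms by (auto simp: Lp_fun_def)
  have "(\<integral>\<^sup>+x. ennreal (norm (f x) powr p) \<partial>distr N M \<phi>)
      = (\<integral>\<^sup>+y. ennreal (norm (f (\<phi> y)) powr p) \<partial>N)"
    by (rule nn_integral_distr[OF measurable_\<phi>]) measurable
  with fin show ?thesis
    using measurable_compose[OF measurable_\<phi> f] by (simp add: Lp_fun_def distr_\<phi>)
qed

text \<open>A null set of \<open>M\<close> has an \<open>N\<close>-null preimage under \<phi>, since
  the push-forward of \<open>N\<close> is \<open>M\<close>. This is what lets composition with
  \<phi> descend to classes.\<close>

lemma AE_comp: "AE x in M. P x \<Longrightarrow> AE y in N. P (\<phi> y)"
  by (rule AE_distrD[OF measurable_\<phi>]) (simp only: distr_\<phi>)

lemma Lp_class_comp_eqI: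
  assumes "f \<in> Lp_fun M p" "g \<in> Lp_fun M p" "AE x in M. f x = g x"
  shows "Lp_class N p (\<lambda>y. f (\<phi> y)) = Lp_class N p (\<lambda>y. g (\<phi> y))"
  using assms by (intro Lp_class_eqI Lp_fun_comp AE_comp)

text \<open>The union over representatives copies the shape of \<open>U_op\<close>, so that the two
  agree by unfolding once \<phi> is instantiated.\<close>

definition pullback :: "real \<Rightarrow> ('a \<Rightarrow> complex) set \<Rightarrow> ('b \<Rightarrow> complex) set" where
  "pullback p F = (\<Union>f\<in>F. Lp_class N p (\<lambda>y. f (\<phi> y)))"

lemma pullback_class:
  assumes f: "f \<in> Lp_fun M p"
  shows "pullback p (Lp_class M p f) = Lp_class N p (\<lambda>y. f (\<phi> y))"
proof -
  have "pullback p (Lp_class M p f) = (\<Union>g\<in>Lp_class M p f. Lp_class N p (\<lambda>y. f (\<phi> y)))"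
    unfolding pullback_def
    by (intro SUP_cong refl Lp_class_comp_eqI[symmetric]) (simp_all add: mem_Lp_class)
  \<comment> \<open>The index set is nonempty, so the union of the constant family is its single
    value and not the empty set.\<close>
  moreover have "f \<in> Lp_class M p f" using f by (simp add: mem_Lp_class)
  ultimately show ?thesis by (auto simp: UN_constant_eq)
qed

lemma pullback_in_Lp: "F \<in> Lp M p \<Longrightarrow> pullback p F \<in> Lp N p"
  by (metis Lp_cases Lp_class_in_Lp Lp_fun_comp pullback_class)

lemma pullback_inverse:
  assumes "F \<in> Lp M p"
  shows "measure_preserving_iso.pullback M \<psi> p (pullback p F) = F"
proof -
  interpret inv: measure_preserving_iso N M \<psi> \<phi> by (rule inverse)
  obtain f where f: "f \<in> Lp_fun M p" and F: "F = Lp_class M p f"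
    using assms by (rule Lp_cases)
  have "inv.pullback p (pullback p F) = Lp_class M p (\<lambda>x. f (\<phi> (\<psi> x)))"
    by (simp add: F pullback_class[OF f] inv.pullback_class[OF Lp_fun_comp[OF f]])
  \<comment> \<open>Functions are total, so \<open>f (\<phi> (\<psi> x))\<close> may differ from
    \<open>f x\<close> off \<open>space M\<close>; agreement on \<open>space M\<close> is enough for
    equal classes.\<close>
  also have "\<dots> = Lp_class M p f"
    using f inv.Lp_fun_comp[OF Lp_fun_comp[OF f]]
    by (intro Lp_class_eqI AE_I2) (auto simp: \<phi>_\<psi>)
  finally show ?thesis by (simp add: F)
qed

lemma norm_comp:
  assumes f: "f \<in> Lp_fun M p"
  shows "Lp_norm N p (Lp_class N p (\<lambda>y. f (\<phi> y))) = Lp_norm M p (Lp_class M p f)"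
proof -
  have [measurable]: "f \<in> borel_measurable M" using f by (simp add: Lp_fun_def)
  have "(\<integral>x. norm (f x) powr p \<partial>distr N M \<phi>) = (\<integral>y. norm (f (\<phi> y)) powr p \<partial>N)"
    by (rule integral_distr[OF measurable_\<phi>]) measurable
  then show ?thesis by (simp add: Lp_norm_class f Lp_fun_comp distr_\<phi>)
qed

lemma Lp_linear_isometric_iso_pullback:
  assumes p: "0 \<le> p"
  shows "Lp_linear_isometric_iso M N p (pullback p)"
  unfolding Lp_linear_isometric_iso_def
proof (intro conjI ballI allI)
  \<comment> \<open>The inverse operator is the pullback along \<psi>;
    \<open>pullback_inverse\<close> for each of the two interpretations gives the two
    compositions.\<close>
  interpret inv: measure_preserving_iso N M \<psi> \<phi> by (rule inverse)
  show "bij_betw (pullback p) (Lp M p) (Lp N p)"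
    by (rule bij_betw_byWitness[where f' = "inv.pullback p"])
      (auto simp: pullback_inverse inv.pullback_inverse intro: pullback_in_Lp inv.pullback_in_Lp)
next
  fix F G assume "F \<in> Lp M p" "G \<in> Lp M p"
  then obtain f g where "f \<in> Lp_fun M p" "F = Lp_class M p f" "g \<in> Lp_fun M p" "G = Lp_class M p g"
    by (metis Lp_cases)
  with p show "pullback p (Lp_add M p F G) = Lp_add N p (pullback p F) (pullback p G)"
    by (simp add: Lp_add_class pullback_class Lp_fun_comp Lp_fun_add)
next
  fix c F assume "F \<in> Lp M p"
  then obtain f where "f \<in> Lp_fun M p" "F = Lp_class M p f" by (rule Lp_cases)
  then show "pullback p (Lp_scale M p c F) = Lp_scale N p c (pullback p F)"
    by (simp add: Lp_scale_class pullback_class Lp_fun_comp Lp_fun_scale)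
next
  fix F assume "F \<in> Lp M p"
  then obtain f where "f \<in> Lp_fun M p" "F = Lp_class M p f" by (rule Lp_cases)
  then show "Lp_norm N p (pullback p F) = Lp_norm M p F"
    by (simp add: norm_comp pullback_class)
qed

end

text \<open>Change of variables for the constant function 1 settles the case where
  \<open>\<bar>h x\<bar>\<close> is integrable over \<open>S\<close>. Otherwise both sides are
  infinite, so the formula holds in the extended sense and also covers sets of infinite
  measure.\<close>

lemma emeasure_image_derivative:
  fixes g h :: "real \<Rightarrow> real"
  assumes S: "S \<in> sets lebesgue"
    and deriv: "\<And>x. x \<in> S \<Longrightarrow> (g has_field_derivative h x) (at x within S)"
    and inj: "inj_on g S"
    and h: "h \<in> borel_measurable lebesgue"
  shows "emeasure lebesgue (g ` S) = (\<integral>\<^sup>+x. ennreal \<bar>h x\<bar> * indicator S x \<partial>lebesgue)"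
proof -
  let ?k = "\<lambda>x. indicator S x * \<bar>h x\<bar>"
  \<comment> \<open>Measurability of the image is shown separately because it is needed below to
    pass from "not of finite measure" to "of infinite measure".\<close>
  have image: "g ` S \<in> sets lebesgue"
    using S deriv by (intro differentiable_image_in_sets_lebesgue)
      (auto simp: differentiable_on_def dest: has_field_derivative_imp_has_derivative
        intro: differentiableI)
  have cov: "(\<lambda>x. \<bar>h x\<bar>) absolutely_integrable_on S \<and> integral S (\<lambda>x. \<bar>h x\<bar>) = b
      \<longleftrightarrow> (\<lambda>x. 1 :: real) absolutely_integrable_on (g ` S) \<and> integral (g ` S) (\<lambda>x. 1) = b" for b
    using has_absolute_integral_change_of_variables_1'[OF S deriv inj, of "\<lambda>_. 1" b] by simp
  have k: "(\<integral>\<^sup>+x. ennreal \<bar>h x\<bar> * indicator S x \<partial>lebesgue) = (\<integral>\<^sup>+x. ennreal (?k x) \<partial>lebesgue)"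
    by (rule nn_integral_cong) (auto simp: indicator_def)
  have meas_k: "?k \<in> borel_measurable lebesgue"
    using S h by measurable
  have abs_image: "(\<lambda>x. 1 :: real) absolutely_integrable_on (g ` S) \<longleftrightarrow> g ` S \<in> lmeasurable"
    by (simp add: set_integrable_def lmeasurable_iff_integrable)
  show ?thesis
  proof (cases "(\<lambda>x. \<bar>h x\<bar>) absolutely_integrable_on S")
    case True
    then have int: "integrable lebesgue ?k" by (simp add: set_integrable_def)
    have "g ` S \<in> lmeasurable" and eq: "integral (g ` S) (\<lambda>x. 1 :: real) = integral S (\<lambda>x. \<bar>h x\<bar>)"
      using cov True abs_image by blast+
    then have "emeasure lebesgue (g ` S) = ennreal (integral S (\<lambda>x. \<bar>h x\<bar>))"
      using lmeasure_integral[of "g ` S"] by (simp add: emeasure_eq_measure2)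
    also have "integral S (\<lambda>x. \<bar>h x\<bar>) = (\<integral>x. ?k x \<partial>lebesgue)"
      using set_lebesgue_integral_eq_integral(2)[OF True]
      by (simp add: set_lebesgue_integral_def)
    also have "ennreal \<dots> = (\<integral>\<^sup>+x. ennreal (?k x) \<partial>lebesgue)"
      using int by (intro nn_integral_eq_integral[symmetric]) auto
    finally show ?thesis by (simp add: k)
  next
    case False
    then have "g ` S \<notin> lmeasurable" using cov abs_image by blast
    then have "emeasure lebesgue (g ` S) = \<infinity>"
      using image by (simp add: fmeasurable_def less_top[symmetric])
    \<comment> \<open>For a nonnegative measurable function, failure of integrability means that its
      integral is infinite.\<close>
    moreover have "\<not> integrable lebesgue ?k" using False by (simp add: set_integrable_def)
    then have "(\<integral>\<^sup>+x. ennreal (?k x) \<partial>lebesgue) = \<infinity>"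
      using meas_k by (simp add: integrable_iff_bounded less_top[symmetric])
    ultimately show ?thesis by (simp add: k)
  qed
qed

lemma Psi_inverse:
  assumes "0 < \<delta>"
  shows "0 < t \<Longrightarrow> (\<delta> * Psi \<delta> t) powr (1 / \<delta>) = t"
    and "0 < s \<Longrightarrow> Psi \<delta> ((\<delta> * s) powr (1 / \<delta>)) = s"
  using assms by (simp_all add: Psi_def powr_powr)

lemma Psi_less_iff:
  assumes "0 < \<delta>" "0 < s" "0 < t"
  shows "Psi \<delta> s < Psi \<delta> t \<longleftrightarrow> s < t"
proof -
  have "s powr \<delta> < t powr \<delta> \<longleftrightarrow> s < t"
    using assms by (meson less_imp_le powr_less_cancel2 powr_less_mono2)
  with assms show ?thesis by (simp add: Psi_def divide_less_cancel)
qed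

text \<open>For infinite \<open>T\<close> both upper bounds are vacuous; for finite \<open>T\<close>
  this is strict monotonicity. Having an equivalence serves both maps: it sends \<open>t\<close>
  into the target interval, and read backwards at \<open>(\<delta> * s) powr (1 / \<delta>)\<close>
  it sends \<open>s\<close> into the source.\<close>

lemma Psi_in_einterval_iff:
  assumes "0 < \<delta>" "0 < t" "0 < T"
  shows "Psi \<delta> t \<in> einterval 0 (Psi_end \<delta> T) \<longleftrightarrow> t \<in> einterval 0 T"
proof -
  have "0 < Psi \<delta> t" using assms by (simp add: Psi_def)
  with assms show ?thesis
    by (cases T) (auto simp: einterval_def Psi_end_def Psi_less_iff)
qed

lemma DERIV_Psi:
  assumes "0 < \<delta>" "0 < t"
  shows "(Psi \<delta> has_field_derivative t powr (\<delta> - 1)) (at t within S)"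
proof -
  have "((\<lambda>t. t powr \<delta> / \<delta>) has_field_derivative (\<delta> * t powr (\<delta> - 1)) / \<delta>) (at t within S)"
    using assms by (intro DERIV_cdivide has_real_derivative_powr has_field_derivative_at_within)
  with assms show ?thesis by (simp add: Psi_def[abs_def])
qed

lemma measure_preserving_iso_Psi:
  assumes \<delta>: "0 < \<delta>" and T: "0 < T"
  shows "measure_preserving_iso (weighted_measure \<delta> T) (lebesgue_on (einterval 0 (Psi_end \<delta> T)))
    (\<lambda>s. (\<delta> * s) powr (1 / \<delta>)) (Psi \<delta>)"
proof -
  define I where "I = einterval 0 T"
  define J where "J = einterval 0 (Psi_end \<delta> T)"
  define \<phi> where "\<phi> s = (\<delta> * s) powr (1 / \<delta>)" for s
  let ?M = "weighted_measure \<delta> T" and ?N = "lebesgue_on J"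
  have sets_IJ: "I \<in> sets lebesgue" "J \<in> sets lebesgue"
    by (auto simp: I_def J_def)
  have pos: "t \<in> I \<Longrightarrow> 0 < t" "s \<in> J \<Longrightarrow> 0 < s" for s t
    by (auto simp: I_def J_def einterval_def)
  have Psi_\<phi>: "Psi \<delta> (\<phi> s) = s" if "s \<in> J" for s
    using Psi_inverse(2)[OF \<delta>] pos(2)[OF that] by (simp add: \<phi>_def)
  have \<phi>_Psi: "\<phi> (Psi \<delta> t) = t" if "t \<in> I" for t
    using Psi_inverse(1)[OF \<delta>] pos(1)[OF that] by (simp add: \<phi>_def)
  have Psi_J: "Psi \<delta> t \<in> J" if "t \<in> I" for t
    using Psi_in_einterval_iff[OF \<delta> pos(1)[OF that] T] that by (simp add: I_def J_def)
  have \<phi>_I: "\<phi> s \<in> I" if "s \<in> J" for s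
  proof -
    have "0 < \<phi> s" using \<delta> pos(2)[OF that] by (simp add: \<phi>_def)
    from Psi_in_einterval_iff[OF \<delta> this T] that show ?thesis
      by (simp add: I_def J_def Psi_\<phi>[unfolded J_def])
  qed
  have space_M: "space ?M = I" and sets_M: "sets ?M = sets (lebesgue_on I)"
    by (simp_all add: weighted_measure_def I_def)
  have sets_M_iff: "A \<in> sets ?M \<longleftrightarrow> A \<subseteq> I \<and> A \<in> sets lebesgue" for A
    unfolding sets_M by (rule sets_restrict_space_iff) (simp add: sets_IJ)
  have sets_N_iff: "A \<in> sets ?N \<longleftrightarrow> A \<subseteq> J \<and> A \<in> sets lebesgue" for A
    by (rule sets_restrict_space_iff) (simp add: sets_IJ)
  \<comment> \<open>Continuity alone does not make preimages of Lebesgue sets Lebesgue measurable.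
    Rewriting them as images under the inverse map reduces both measurability claims to the fact
    that differentiable maps send Lebesgue sets to Lebesgue sets.\<close>
  have vimage_\<phi>: "\<phi> -` A \<inter> J = Psi \<delta> ` A" if "A \<subseteq> I" for A
    using that Psi_\<phi> \<phi>_Psi Psi_J by (force simp: image_iff)
  have vimage_Psi: "Psi \<delta> -` A \<inter> I = \<phi> ` A" if "A \<subseteq> J" for A
    using that Psi_\<phi> \<phi>_Psi \<phi>_I by (force simp: image_iff)
  have deriv: "(Psi \<delta> has_field_derivative t powr (\<delta> - 1)) (at t within A)"
    if "t \<in> I" for t A using DERIV_Psi[OF \<delta> pos(1)[OF that]] .
  have "Psi \<delta> ` A \<in> sets lebesgue" if "A \<subseteq> I" "A \<in> sets lebesgue" for A
  proof (rule differentiable_image_in_sets_lebesgue[OF that(2)])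
    show "Psi \<delta> differentiable_on A"
      using that(1) deriv unfolding differentiable_on_def
      by (meson subsetD differentiableI has_field_derivative_imp_has_derivative)
  qed simp
  then have meas_\<phi>: "\<phi> \<in> measurable ?N ?M"
    by (intro measurableI)
      (auto simp: space_M sets_M_iff sets_N_iff vimage_\<phi> \<phi>_I Psi_J)
  have "\<phi> ` A \<in> sets lebesgue" if A: "A \<subseteq> J" "A \<in> sets lebesgue" for A
  proof (rule differentiable_image_in_sets_lebesgue[OF A(2)])
    \<comment> \<open>The base \<open>\<delta> * s\<close> is positive on \<open>J\<close>, so the
      real power with exponent \<open>1 / \<delta>\<close> is differentiable there.\<close>
    have "\<phi> differentiable (at s within A)" if "s \<in> A" for s
    proof -
      have "0 < \<delta> * s" using \<delta> pos(2) A(1) that by auto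
      from DERIV_chain2[OF has_real_derivative_powr[OF this] DERIV_cmult_Id]
      show ?thesis unfolding \<phi>_def[abs_def]
        by (meson differentiableI has_field_derivative_imp_has_derivative)
    qed
    then show "\<phi> differentiable_on A" by (simp add: differentiable_on_def)
  qed simp
  then have meas_Psi: "Psi \<delta> \<in> measurable ?M ?N"
    by (intro measurableI)
      (auto simp: space_M sets_M_iff sets_N_iff vimage_Psi \<phi>_I Psi_J)
  have "distr ?N ?M \<phi> = ?M"
  proof (rule measure_eqI)
    fix A assume "A \<in> sets (distr ?N ?M \<phi>)"
    then have AM: "A \<in> sets ?M" and A: "A \<subseteq> I" "A \<in> sets lebesgue"
      by (simp_all add: sets_M_iff)
    have w: "(\<lambda>t. ennreal (t powr (\<delta> - 1))) \<in> borel_measurable (lebesgue_on I)"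
      by (intro measurable_restrict_space1 measurable_completion) simp
    have "emeasure (distr ?N ?M \<phi>) A = emeasure ?N (Psi \<delta> ` A)"
      using A by (simp add: emeasure_distr[OF meas_\<phi> AM] vimage_\<phi>)
    also have "\<dots> = emeasure lebesgue (Psi \<delta> ` A)"
      using A(1) sets_IJ Psi_J by (intro emeasure_restrict_space) auto
    also have "\<dots> = (\<integral>\<^sup>+t. ennreal \<bar>t powr (\<delta> - 1)\<bar> * indicator A t \<partial>lebesgue)"
    proof (rule emeasure_image_derivative[OF A(2)])
      show "inj_on (Psi \<delta>) A" using A(1) \<phi>_Psi by (metis inj_on_def subsetD)
      show "(\<lambda>t. t powr (\<delta> - 1)) \<in> borel_measurable lebesgue"
        by (intro measurable_completion) simp
    qed (use A(1) deriv in auto)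
    \<comment> \<open>The extra indicator changes nothing because \<open>A \<subseteq> I\<close>; it
      gives the integrand the form needed to pass to the restricted measure.\<close>
    also have "\<dots> = (\<integral>\<^sup>+t. ennreal (t powr (\<delta> - 1)) * indicator A t * indicator I t \<partial>lebesgue)"
      using A(1) by (intro nn_integral_cong) (auto simp: indicator_def)
    also have "\<dots> = (\<integral>\<^sup>+t. ennreal (t powr (\<delta> - 1)) * indicator A t \<partial>lebesgue_on I)"
      by (rule nn_integral_restrict_space[symmetric]) (simp add: sets_IJ)
    also have "\<dots> = emeasure ?M A"
      using emeasure_density[OF w] AM by (simp add: sets_M) (simp add: weighted_measure_def I_def)
    finally show "emeasure (distr ?N ?M \<phi>) A = emeasure ?M A" .
  qed simp
  with meas_\<phi> meas_Psi have "measure_preserving_iso ?M ?N \<phi> (Psi \<delta>)"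
    by unfold_locales (simp_all add: space_M \<phi>_Psi Psi_\<phi>)
  then show ?thesis by (simp add: J_def \<phi>_def[abs_def])
qed

text \<open>The middle conjunct ensures that the union defining \<open>U_op\<close> really is one
  class, namely that of the composed representative.\<close>

theorem proposition2:
  fixes p \<delta> :: real and T :: ereal
  assumes "1 \<le> p" and "0 < \<delta>" and "\<delta> \<le> 1" and "0 < T"
  shows "strict_mono_on (einterval 0 T) (Psi \<delta>) \<and>
    (\<forall>f\<in>Lp_fun (weighted_measure \<delta> T) p.
       U_fun \<delta> f \<in> Lp_fun (lebesgue_on (einterval 0 (Psi_end \<delta> T))) p \<and>
       U_op p \<delta> T (Lp_class (weighted_measure \<delta> T) p f) =
         Lp_class (lebesgue_on (einterval 0 (Psi_end \<delta> T))) p (U_fun \<delta> f)) \<and>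
    Lp_linear_isometric_iso (weighted_measure \<delta> T) (lebesgue_on (einterval 0 (Psi_end \<delta> T))) p
      (U_op p \<delta> T)"
proof -
  interpret measure_preserving_iso "weighted_measure \<delta> T" "lebesgue_on (einterval 0 (Psi_end \<delta> T))"
    "\<lambda>s. (\<delta> * s) powr (1 / \<delta>)" "Psi \<delta>"
    using assms by (intro measure_preserving_iso_Psi)
  have U_fun: "U_fun \<delta> f = (\<lambda>s. f ((\<delta> * s) powr (1 / \<delta>)))" for f
    by (simp add: U_fun_def[abs_def])
  have U_op: "U_op p \<delta> T = pullback p"
    by (simp add: fun_eq_iff U_op_def pullback_def U_fun)
  have "strict_mono_on (einterval 0 T) (Psi \<delta>)"
    using assms by (intro strict_mono_onI) (auto simp: einterval_def Psi_less_iff)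
  then show ?thesis
    using assms Lp_linear_isometric_iso_pullback[of p] Lp_fun_comp[of _ p] pullback_class[of _ p]
    unfolding U_op U_fun by simp
qed

end
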